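(* For any $2n\times 2n$ complex invertible matrix $G$, there exist a $2n\times 2n$ unitary matrix $U$, a $2n\times 2n$ complex symplectic matrix $S$, and a unique (up to permutation of the diagonal) $n\times n$ positive diagonal matrix $\Sigma$ such that $$G=U\begin{bmatrix}\Sigma & 0\\ 0&\Sigma\end{bmatrix}S.$$
   Context: A complex symplectic matrix is $S\in\mathbb{C}^{2n\times 2n}$ with $S^TJ_nS=J_n$, where $J_n=\begin{bmatrix}0&I_n\\-I_n&0\end{bmatrix}$ and $^T$ is the ordinary (non-conjugate) transpose. A positive diagonal matrix is a real diagonal matrix with positive diagonal entries. *)

theory Defs
  imports
    "Jordan_Normal_Form.Schur_Decomposition"
    "HOL-Combinatorics.Permutations"
begin

definition J_mat :: "nat \<Rightarrow> complex mat" where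
  "J_mat n = four_block_mat (0\<^sub>m n n) (1\<^sub>m n) (- 1\<^sub>m n) (0\<^sub>m n n)"

text \<open>Here the transpose is not conjugated, so these are the matrices of the complex
  symplectic group, as opposed to the conjugate symplectic ones.\<close>

definition complex_symplectic :: "nat \<Rightarrow> complex mat \<Rightarrow> bool" where
  "complex_symplectic n S \<longleftrightarrow>
     S \<in> carrier_mat (2 * n) (2 * n) \<and> S\<^sup>T * J_mat n * S = J_mat n"

definition unitary_mat :: "nat \<Rightarrow> complex mat \<Rightarrow> bool" where
  "unitary_mat m U \<longleftrightarrow>
     U \<in> carrier_mat m m \<and> mat_adjoint U * U = 1\<^sub>m m \<and> U * mat_adjoint U = 1\<^sub>m m"

definition positive_diagonal :: "nat \<Rightarrow> real mat \<Rightarrow> bool" where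
  "positive_diagonal n \<Sigma> \<longleftrightarrow>
     \<Sigma> \<in> carrier_mat n n \<and> diagonal_mat \<Sigma> \<and> (\<forall>i<n. 0 < \<Sigma> $$ (i, i))"

definition double_block :: "nat \<Rightarrow> real mat \<Rightarrow> complex mat" where
  "double_block n \<Sigma> =
     four_block_mat (map_mat complex_of_real \<Sigma>) (0\<^sub>m n n)
                    (0\<^sub>m n n) (map_mat complex_of_real \<Sigma>)"

definition equal_up_to_diagonal_permutation :: "nat \<Rightarrow> real mat \<Rightarrow> real mat \<Rightarrow> bool" where
  "equal_up_to_diagonal_permutation n \<Sigma> \<Sigma>' \<longleftrightarrow>
     (\<exists>\<pi>. \<pi> permutes {..<n} \<and> (\<forall>i<n. \<Sigma>' $$ (i, i) = \<Sigma> $$ (\<pi> i, \<pi> i)))"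

end

theory Submission
  imports Defs
begin

text \<open>Put \<open>D\<close> for the doubled \<open>\<Sigma>\<close>. Since \<open>S\<close> is symplectic iff \<open>S J S\<^sup>T = J\<close>, a factorization
  \<open>G = U D S\<close> is the same as a Youla decomposition \<open>K = U (D J D) U\<^sup>T\<close> of the skew-symmetric
  matrix \<open>K = G J G\<^sup>T\<close>. Uniqueness holds because \<open>K\<close> times its conjugate is then unitarily similar
  to \<open>- D\<^sup>4\<close>. For existence, let \<open>\<tau> z\<close> be \<open>K\<close> applied to the conjugate of \<open>z\<close>. A unit eigenvector
  \<open>x\<close> of \<open>\<tau>\<^sup>2\<close> with nonzero eigenvalue \<open>- s\<^sup>2\<close> yields the orthonormal pair \<open>x\<close>, \<open>- \<tau> x / s\<close>, whose
  span and, by skewness, orthogonal complement are \<open>\<tau>\<close>-invariant; repeating this in the complement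
  gives the columns of \<open>U\<close>.\<close>

section \<open>Conjugation, Hermitian products and skew forms\<close>

lemma map_cnj_mult:
  assumes "A \<in> carrier_mat nr n" "B \<in> carrier_mat n nc"
  shows "map_mat cnj (A * B) = map_mat cnj A * map_mat cnj B"
  using assms by (intro eq_matI) (auto simp: scalar_prod_def)

lemma conjugate_mult_mat_vec:
  fixes A :: "complex mat"
  assumes "A \<in> carrier_mat nr n" "v \<in> carrier_vec n"
  shows "conjugate (A *\<^sub>v v) = map_mat cnj A *\<^sub>v conjugate v"
  using assms by (intro eq_vecI) (auto simp: scalar_prod_def)

lemma map_cnj_map_cnj [simp]: "map_mat cnj (map_mat cnj A) = A"
  by (intro eq_matI) auto

lemma mat_adjoint_eq: "mat_adjoint A = map_mat cnj A\<^sup>T"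
  unfolding mat_adjoint_def by (intro eq_matI) (auto simp: mat_of_rows_def)

lemma cscalar_prod_self:
  fixes v :: "complex vec"
  shows "v \<bullet>c v = complex_of_real (\<Sum>i<dim_vec v. (cmod (v $ i))\<^sup>2)"
  by (simp add: scalar_prod_def lessThan_atLeast0 flip: complex_norm_square)

lemma cscalar_prod_swap:
  fixes v w :: "complex vec"
  assumes "v \<in> carrier_vec n" "w \<in> carrier_vec n"
  shows "w \<bullet>c v = cnj (v \<bullet>c w)"
  using assms by (simp add: scalar_prod_def mult.commute)

text \<open>Moving \<open>K\<close> across the bilinear product turns it into its transpose. On
  conjugated arguments this becomes a rule for \<tau>: the Hermitian product of \<tau> u with v is
  minus that of \<tau> v with u. So \<tau> u is orthogonal to u, and orthogonality to a
  \<tau>-invariant span is inherited by images under \<tau>.\<close>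

lemma skew_scalar_prod:
  fixes K :: "complex mat"
  assumes K: "K \<in> carrier_mat N N" "K\<^sup>T = - K" and u: "u \<in> carrier_vec N" and v: "v \<in> carrier_vec N"
  shows "(K *\<^sub>v u) \<bullet> v = - ((K *\<^sub>v v) \<bullet> u)"
proof -
  have "(K *\<^sub>v u) \<bullet> v = (K\<^sup>T *\<^sub>v v) \<bullet> u"
    using transpose_vec_mult_scalar[OF K(1) u v] K u v
    by (metis comm_scalar_prod mult_mat_vec_carrier transpose_carrier_mat)
  also have "\<dots> = - ((K *\<^sub>v v) \<bullet> u)"
    using K u v by (simp add: uminus_scalar_prod)
  finally show ?thesis .
qed

section \<open>Nonzero eigenvalues from the trace\<close>

text \<open>The trace of a product does not change when its two factors are swapped; here the
  factors are \<open>P\<close> and \<open>B * Q\<close>.\<close>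

lemma sum_diag_similar:
  fixes A :: "complex mat"
  assumes "similar_mat A B" "A \<in> carrier_mat N N"
  shows "(\<Sum>i<N. A $$ (i,i)) = (\<Sum>i<N. B $$ (i,i))"
proof -
  obtain P Q where PQ: "similar_mat_wit A B P Q" using assms by (auto simp: similar_mat_def)
  note w = similar_mat_witD2[OF assms(2) PQ]
  have tr: "(\<Sum>i<N. (X * Y) $$ (i,i)) = (\<Sum>i<N. (Y * X) $$ (i,i))"
    if "X \<in> carrier_mat N N" "Y \<in> carrier_mat N N" for X Y :: "complex mat"
  proof -
    have "(\<Sum>i<N. (X * Y) $$ (i,i)) = (\<Sum>i<N. \<Sum>j<N. X $$ (i,j) * Y $$ (j,i))"
      using that by (auto simp: scalar_prod_def lessThan_atLeast0)
    also have "\<dots> = (\<Sum>j<N. \<Sum>i<N. X $$ (i,j) * Y $$ (j,i))" by (rule sum.swap)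
    also have "\<dots> = (\<Sum>i<N. (Y * X) $$ (i,i))"
      using that by (auto simp: scalar_prod_def lessThan_atLeast0 mult.commute)
    finally show ?thesis .
  qed
  have "(\<Sum>i<N. A $$ (i,i)) = (\<Sum>i<N. (P * (B * Q)) $$ (i,i))" using w by simp
  also have "\<dots> = (\<Sum>i<N. ((B * Q) * P) $$ (i,i))" using w by (intro tr) auto
  also have "(B * Q) * P = B" using w by simp
  finally show ?thesis .
qed

text \<open>A Schur form carries the roots of the characteristic polynomial on its diagonal, so the
  trace is the sum of these roots, and a nonzero sum has a nonzero term.\<close>

lemma nonzero_trace_imp_eigenvector:
  fixes A :: "complex mat"
  assumes A: "A \<in> carrier_mat N N" and tr: "(\<Sum>i<N. A $$ (i,i)) \<noteq> 0"
  obtains e x where "e \<noteq> 0" "eigenvector A x e"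
proof -
  obtain es where es: "char_poly A = (\<Prod>e\<leftarrow>es. [:- e, 1:])" "length es = N"
    using char_poly_factorized[OF A] by auto
  obtain B P Q where s: "schur_decomposition A es = (B, P, Q)" by (metis prod_cases3)
  from schur_decomposition[OF A es(1) s]
  have B: "similar_mat A B" and d: "diag_mat B = es" by (auto simp: similar_mat_def)
  have "dim_row B = N" using d es(2) by (auto simp: diag_mat_def)
  hence "\<And>i. i < N \<Longrightarrow> B $$ (i,i) = es ! i" using d by (auto simp: diag_mat_def)
  hence "(\<Sum>i<N. es ! i) \<noteq> 0" using tr sum_diag_similar[OF B A] by simp
  then obtain i where "i < N" "es ! i \<noteq> 0" by (meson lessThan_iff sum.not_neutral_contains_not_neutral)
  then obtain e where e: "e \<in> set es" "e \<noteq> 0" using es(2) by (metis nth_mem)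
  have "poly (char_poly A) e = 0" unfolding es(1) using e(1) by (auto simp: poly_prod_list prod_list_zero_iff)
  hence "eigenvalue A e" using eigenvalue_root_char_poly[OF A] by simp
  thus thesis using that[OF e(2)] by (auto simp: eigenvalue_def)
qed

section \<open>Splitting off orthonormal pairs\<close>

text \<open>For a unit eigenvector \<open>x\<close> of \<tau> squared, skewness forces the
  eigenvalue to be minus the squared norm of \<tau> x. It is therefore real and negative, and
  \<open>s\<close> is the norm of \<tau> x.\<close>

lemma skew_pair:
  fixes K :: "complex mat"
  assumes K: "K \<in> carrier_mat N N" and sk: "K\<^sup>T = - K" and nz: "K \<noteq> 0\<^sub>m N N"
  obtains x y and s :: real where "x \<in> carrier_vec N" "y \<in> carrier_vec N" "s > 0"
    "x \<bullet>c x = 1" "y \<bullet>c y = 1" "x \<bullet>c y = 0"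
    "K *\<^sub>v conjugate x = - complex_of_real s \<cdot>\<^sub>v y" "K *\<^sub>v conjugate y = complex_of_real s \<cdot>\<^sub>v x"
proof -
  let ?A = "K * map_mat cnj K"
  have skew: "K $$ (j,i) = - K $$ (i,j)" if "i < N" "j < N" for i j
    using arg_cong[OF sk, of "\<lambda>M. M $$ (i,j)"] K that by auto
  \<comment> \<open>The trace of \<open>?A\<close> is minus the squared Frobenius norm of \<open>K\<close>, so \<open>?A\<close> has a nonzero eigenvalue.\<close>
  have "(\<Sum>i<N. ?A $$ (i,i)) = (\<Sum>i<N. \<Sum>j<N. K $$ (i,j) * cnj (K $$ (j,i)))"
    using K by (auto simp: scalar_prod_def lessThan_atLeast0)
  also have "\<dots> = (\<Sum>i<N. \<Sum>j<N. - complex_of_real ((cmod (K $$ (i,j)))\<^sup>2))"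
  proof (intro sum.cong refl)
    fix i j assume "i \<in> {..<N}" "j \<in> {..<N}"
    hence "K $$ (j,i) = - K $$ (i,j)" using skew[of i j] by simp
    thus "K $$ (i,j) * cnj (K $$ (j,i)) = - complex_of_real ((cmod (K $$ (i,j)))\<^sup>2)"
      using complex_norm_square[of "K $$ (i,j)"] by simp
  qed
  also have "\<dots> = - complex_of_real (\<Sum>i<N. \<Sum>j<N. (cmod (K $$ (i,j)))\<^sup>2)"
    by (simp add: sum_negf)
  finally have tr: "(\<Sum>i<N. ?A $$ (i,i)) = - complex_of_real (\<Sum>i<N. \<Sum>j<N. (cmod (K $$ (i,j)))\<^sup>2)" .
  have "(\<Sum>i<N. ?A $$ (i,i)) \<noteq> 0"
  proof
    assume "(\<Sum>i<N. ?A $$ (i,i)) = 0"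
    hence "complex_of_real (\<Sum>i<N. \<Sum>j<N. (cmod (K $$ (i,j)))\<^sup>2) = 0"
      unfolding tr neg_equal_0_iff_equal .
    hence "(\<Sum>i<N. \<Sum>j<N. (cmod (K $$ (i,j)))\<^sup>2) = 0" unfolding of_real_eq_0_iff .
    hence "\<forall>i<N. \<forall>j<N. K $$ (i,j) = 0"
      by (simp add: sum_nonneg_eq_0_iff sum_nonneg)
    thus False using nz K by auto
  qed
  then obtain e v where e: "e \<noteq> 0" and ev: "eigenvector ?A v e"
    using nonzero_trace_imp_eigenvector[of ?A N] K by auto
  have v: "v \<in> carrier_vec N" "v \<noteq> 0\<^sub>v N" and Av: "?A *\<^sub>v v = e \<cdot>\<^sub>v v"
    using ev K by (auto simp: eigenvector_def)
  define q where "q = (\<Sum>i<N. (cmod (v $ i))\<^sup>2)"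
  have q: "v \<bullet>c v = complex_of_real q" using v unfolding cscalar_prod_self q_def by simp
  have "q \<ge> 0" by (simp add: q_def sum_nonneg)
  moreover have "q \<noteq> 0" using q v by (metis conjugate_square_eq_0_vec of_real_0)
  ultimately have q0: "q > 0" by simp
  define x where "x = complex_of_real (1 / sqrt q) \<cdot>\<^sub>v v"
  have x: "x \<in> carrier_vec N" using v by (simp add: x_def)
  have xx: "x \<bullet>c x = 1"
  proof -
    have "x \<bullet>c x = complex_of_real (1 / sqrt q) * (complex_of_real (1 / sqrt q) * (v \<bullet>c v))"
      using v unfolding x_def by (simp add: conjugate_smult_vec)
    also have "\<dots> = complex_of_real ((1 / sqrt q) * ((1 / sqrt q) * q))" by (simp only: q of_real_mult)
    also have "(1 / sqrt q) * ((1 / sqrt q) * q) = 1" using q0 by (simp add: field_simps)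
    finally show ?thesis by simp
  qed
  define t where "t = K *\<^sub>v conjugate x"
  have t: "t \<in> carrier_vec N" using K x by (simp add: t_def)
  have "conjugate t = map_mat cnj K *\<^sub>v x"
    using conjugate_mult_mat_vec[OF K, of "conjugate x"] x by (simp add: t_def)
  \<comment> \<open>Two antilinear steps compose to a linear map: \<tau> squared is multiplication
    by \<open>?A\<close>.\<close>
  hence "K *\<^sub>v conjugate t = ?A *\<^sub>v x" using K x by simp
  also have "\<dots> = complex_of_real (1 / sqrt q) \<cdot>\<^sub>v (?A *\<^sub>v v)"
    unfolding x_def using K v by (intro mult_mat_vec[of _ N N]) auto
  also have "\<dots> = e \<cdot>\<^sub>v x" unfolding Av x_def by (simp add: smult_smult_assoc mult.commute)
  finally have Kt: "K *\<^sub>v conjugate t = e \<cdot>\<^sub>v x" .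
  define r where "r = (\<Sum>i<N. (cmod (t $ i))\<^sup>2)"
  have r: "t \<bullet>c t = complex_of_real r" using t unfolding cscalar_prod_self r_def by simp
  have "t \<bullet>c t = - ((K *\<^sub>v conjugate t) \<bullet> conjugate x)"
    unfolding t_def[symmetric] using skew_scalar_prod[OF K sk, of "conjugate x" "conjugate t"] x t
    by (simp add: t_def)
  also have "\<dots> = - e" using xx x by (simp add: Kt)
  finally have er: "e = - complex_of_real r" using r by simp
  have "r \<ge> 0" by (simp add: r_def sum_nonneg)
  hence r0: "r > 0" using er e by (cases "r = 0") auto
  \<comment> \<open>Skewness with both arguments equal to \<open>conjugate x\<close> makes the
    product its own negative.\<close>
  have xt: "x \<bullet>c t = 0"
  proof -
    have "t \<bullet>c x = - (t \<bullet>c x)"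
      using skew_scalar_prod[OF K sk, of "conjugate x" "conjugate x"] x by (simp add: t_def)
    hence "t \<bullet>c x = 0" by simp
    thus ?thesis using cscalar_prod_swap[OF t x] by simp
  qed
  define s where "s = sqrt r"
  have s: "s > 0" "s * s = r" using r0 by (auto simp: s_def)
  \<comment> \<open>Dividing by \<open>s\<close> normalizes \<open>t\<close>. The minus sign matches
    the lower left block of \<open>J_mat\<close>: the first vector of a pair goes to a negative
    multiple of the second.\<close>
  define y where "y = complex_of_real (- 1 / s) \<cdot>\<^sub>v t"
  have y: "y \<in> carrier_vec N" using t by (simp add: y_def)
  have cy: "conjugate y = complex_of_real (- 1 / s) \<cdot>\<^sub>v conjugate t"
    by (simp add: y_def conjugate_smult_vec)
  show thesis
  proof (rule that[OF x y s(1) xx])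
    have "y \<bullet>c y = complex_of_real ((- 1 / s) * ((- 1 / s) * r))"
      unfolding cy using t by (simp only: y_def of_real_mult flip: r) simp
    also have "(- 1 / s) * ((- 1 / s) * r) = 1" using s r0 by (simp add: field_simps)
    finally show "y \<bullet>c y = 1" by simp
    show "x \<bullet>c y = 0" unfolding cy using x t xt by simp
    show "K *\<^sub>v conjugate x = - complex_of_real s \<cdot>\<^sub>v y"
      unfolding y_def t_def[symmetric] using s by (simp add: smult_smult_assoc)
    have "K *\<^sub>v conjugate y = complex_of_real (- 1 / s) \<cdot>\<^sub>v (K *\<^sub>v conjugate t)"
      unfolding cy using K t by (intro mult_mat_vec[of _ N N]) auto
    also have "\<dots> = complex_of_real ((- 1 / s) * (- r)) \<cdot>\<^sub>v x"
      unfolding Kt er by (simp add: smult_smult_assoc)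
    also have "(- 1 / s) * (- r) = s" using s by (simp add: field_simps)
    finally show "K *\<^sub>v conjugate y = complex_of_real s \<cdot>\<^sub>v x" .
  qed
qed

text \<open>The \<open>m\<close> orthogonality conditions, padded with zero rows, form a square
  matrix. Its last row is zero because \<open>m < N\<close>, so it is singular and has a nonzero
  kernel vector.\<close>

lemma exists_orthogonal_vec:
  fixes w :: "nat \<Rightarrow> complex vec"
  assumes w: "\<And>i. i < m \<Longrightarrow> w i \<in> carrier_vec N" and m: "m < N"
  obtains z where "z \<in> carrier_vec N" "z \<noteq> 0\<^sub>v N" "\<And>i. i < m \<Longrightarrow> z \<bullet>c w i = 0"
proof -
  define A where "A = mat N N (\<lambda>(i,j). if i < m then cnj (w i $ j) else 0)"
  have A: "A \<in> carrier_mat N N" by (simp add: A_def)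
  have "A\<^sup>T *\<^sub>v unit_vec N (N - 1) = 0\<^sub>v N" using m by (intro eq_vecI) (auto simp: A_def)
  moreover have "unit_vec N (N - 1) \<noteq> (0\<^sub>v N :: complex vec)"
    using m by (metis diff_less index_unit_vec(2) index_zero_vec(1) less_one not_less_zero gr0I zero_neq_one)
  ultimately have "det A\<^sup>T = 0"
    using det_0_iff_vec_prod_zero[of "A\<^sup>T" N] A by (metis transpose_carrier_mat unit_vec_carrier)
  hence "det A = 0" using det_transpose[OF A] by simp
  then obtain z where z: "z \<in> carrier_vec N" "z \<noteq> 0\<^sub>v N" "A *\<^sub>v z = 0\<^sub>v N"
    using det_0_iff_vec_prod_zero[OF A] by blast
  have "z \<bullet>c w i = 0" if i: "i < m" for i
  proof -
    have "row A i = conjugate (w i)" using i m w[OF i] by (intro eq_vecI) (auto simp: A_def)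
    moreover have "row A i \<bullet> z = 0" using arg_cong[OF z(3), of "\<lambda>v. v $ i"] i m A by simp
    ultimately show ?thesis using z(1) w[OF i] by (metis carrier_vec_conjugate comm_scalar_prod)
  qed
  thus thesis using that z by blast
qed

text \<open>This is the deflation step: \<open>inv\<close> says that the orthogonal complement of
  the \<open>w i\<close> is invariant under \<tau>, so compressing \<open>K\<close> to that
  complement keeps it skew and loses nothing there.\<close>

lemma skew_pair_orthogonal:
  fixes K :: "complex mat"
  assumes K: "K \<in> carrier_mat N N" and sk: "K\<^sup>T = - K" and inj: "det K \<noteq> 0"
    and w: "\<And>i. i < m \<Longrightarrow> w i \<in> carrier_vec N" and m: "m < N"
    and orth: "\<And>i j. i < m \<Longrightarrow> j < m \<Longrightarrow> w i \<bullet>c w j = (if i = j then 1 else 0)"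
    and inv: "\<And>z i. z \<in> carrier_vec N \<Longrightarrow> (\<And>j. j < m \<Longrightarrow> z \<bullet>c w j = 0) \<Longrightarrow> i < m \<Longrightarrow>
      (K *\<^sub>v conjugate z) \<bullet>c w i = 0"
  obtains x y and s :: real where "x \<in> carrier_vec N" "y \<in> carrier_vec N" "s > 0"
    "x \<bullet>c x = 1" "y \<bullet>c y = 1" "x \<bullet>c y = 0"
    "K *\<^sub>v conjugate x = - complex_of_real s \<cdot>\<^sub>v y" "K *\<^sub>v conjugate y = complex_of_real s \<cdot>\<^sub>v x"
    "\<And>i. i < m \<Longrightarrow> x \<bullet>c w i = 0" "\<And>i. i < m \<Longrightarrow> y \<bullet>c w i = 0"
proof -
  define W where "W = mat N m (\<lambda>(a,j). w j $ a)"
  define V where "V = mat m N (\<lambda>(j,a). cnj (w j $ a))"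
  define R where "R = 1\<^sub>m N - W * V"
  have c: "W \<in> carrier_mat N m" "V \<in> carrier_mat m N" by (auto simp: W_def V_def)
  have R: "R \<in> carrier_mat N N" using c by (auto simp: R_def)
  have colW: "col W j = w j" if "j < m" for j
    using that w[OF that] by (intro eq_vecI) (auto simp: W_def)
  have rowV: "row V j = conjugate (w j)" if "j < m" for j
    using that w[OF that] by (intro eq_vecI) (auto simp: V_def)
  have Vz: "V *\<^sub>v z = vec m (\<lambda>j. z \<bullet>c w j)" if "z \<in> carrier_vec N" for z
    using that c w by (intro eq_vecI) (auto simp: rowV intro!: comm_scalar_prod[of _ N])
  have V0: "V *\<^sub>v z = 0\<^sub>v m \<longleftrightarrow> (\<forall>j<m. z \<bullet>c w j = 0)" if "z \<in> carrier_vec N" for z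
    unfolding Vz[OF that] by (auto simp: vec_eq_iff)
  have VW: "V * W = 1\<^sub>m m"
  proof (rule eq_matI)
    fix i j assume "i < dim_row (1\<^sub>m m)" "j < dim_col (1\<^sub>m m)"
    hence ij: "i < m" "j < m" by auto
    hence "(V * W) $$ (i,j) = conjugate (w i) \<bullet> w j" using c by (simp add: rowV colW)
    also have "\<dots> = w j \<bullet>c w i" using w[OF ij(1)] w[OF ij(2)] by (intro comm_scalar_prod[of _ N]) auto
    finally show "(V * W) $$ (i,j) = 1\<^sub>m m $$ (i,j)" using ij orth[of j i] by auto
  qed (use c in auto)
  have VR: "V * R = 0\<^sub>m m N"
  proof -
    have "V * R = V * 1\<^sub>m N - V * (W * V)" unfolding R_def
      using c by (intro mult_minus_distrib_mat[of _ m N _ N]) auto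
    also have "V * (W * V) = (V * W) * V" using c by simp
    finally show ?thesis using c by (simp add: VW)
  qed
  have Rfix: "R *\<^sub>v z = z" if "z \<in> carrier_vec N" "V *\<^sub>v z = 0\<^sub>v m" for z
  proof -
    have "R *\<^sub>v z = 1\<^sub>m N *\<^sub>v z - (W * V) *\<^sub>v z" unfolding R_def
      using c that by (intro minus_mult_distrib_mat_vec[of _ N N]) auto
    also have "(W * V) *\<^sub>v z = 0\<^sub>v N" using c that by (intro eq_vecI) auto
    finally show ?thesis using that by simp
  qed
  \<comment> \<open>\<open>R\<close> is Hermitian since \<open>V\<close> is the adjoint of
    \<open>W\<close>. Hence the right factor of \<open>R * K * R\<^sup>T\<close> slips under the
    conjugation, and \<open>K'\<close> acts as \<tau> between two copies of the projection.\<close>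
  have RT: "R\<^sup>T = map_mat cnj R"
    by (intro eq_matI)
      (auto simp: R_def W_def V_def scalar_prod_def mult.commute)
  \<comment> \<open>\<open>R\<close> projects onto the complement of the \<open>w i\<close>. The range of \<open>R * K * R\<^sup>T\<close> lies in that
    complement, where the matrix agrees with \<open>K\<close>, so any pair for it is a pair for \<open>K\<close> orthogonal
    to the \<open>w i\<close>.\<close>
  define K' where "K' = R * K * R\<^sup>T"
  have K': "K' \<in> carrier_mat N N" using R K by (simp add: K'_def)
  have K'_apply: "K' *\<^sub>v conjugate z = R *\<^sub>v (K *\<^sub>v conjugate (R *\<^sub>v z))" if "z \<in> carrier_vec N" for z
    using R K that unfolding K'_def RT by (simp add: conjugate_mult_mat_vec[OF R that] assoc_mult_mat_vec[of _ N N _ N] del: assoc_mult_mat)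
  have K'_eq: "K' *\<^sub>v conjugate z = K *\<^sub>v conjugate z" if "z \<in> carrier_vec N" "V *\<^sub>v z = 0\<^sub>v m" for z
  proof -
    have "V *\<^sub>v (K *\<^sub>v conjugate z) = 0\<^sub>v m"
      using inv[OF that(1)] that V0 K by auto
    thus ?thesis unfolding K'_apply[OF that(1)] Rfix[OF that] using K that by (intro Rfix) auto
  qed
  have sk': "K'\<^sup>T = - K'"
  proof -
    have "K'\<^sup>T = R * (K\<^sup>T * R\<^sup>T)" unfolding K'_def
      using R K by (simp add: transpose_mult[of _ N N _ N])
    thus ?thesis unfolding K'_def sk using R K by simp
  qed
  \<comment> \<open>The complement contains a nonzero vector as \<open>m < N\<close>, and on it
    \<open>K'\<close> acts like the invertible matrix \<open>K\<close>.\<close>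
  have nz: "K' \<noteq> 0\<^sub>m N N"
  proof
    assume 0: "K' = 0\<^sub>m N N"
    obtain z where z: "z \<in> carrier_vec N" "z \<noteq> 0\<^sub>v N" "\<And>i. i < m \<Longrightarrow> z \<bullet>c w i = 0"
      by (rule exists_orthogonal_vec[of m w N]) (use w m in blast)+
    have "0\<^sub>m N N *\<^sub>v conjugate z = 0\<^sub>v N" using z by (intro eq_vecI) auto
    hence "K *\<^sub>v conjugate z = 0\<^sub>v N" using K'_eq[of z] z V0[of z] by (simp add: 0)
    moreover have "conjugate z \<noteq> 0\<^sub>v N" using z by simp
    ultimately show False using inj det_0_iff_vec_prod_zero[OF K] z(1) by (metis carrier_vec_conjugate)
  qed
  obtain x y and s :: real where xy: "x \<in> carrier_vec N" "y \<in> carrier_vec N" "s > 0"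
    "x \<bullet>c x = 1" "y \<bullet>c y = 1" "x \<bullet>c y = 0"
    "K' *\<^sub>v conjugate x = - complex_of_real s \<cdot>\<^sub>v y" "K' *\<^sub>v conjugate y = complex_of_real s \<cdot>\<^sub>v x"
    by (rule skew_pair[OF K' sk' nz])
  have VK': "V *\<^sub>v (K' *\<^sub>v conjugate z) = 0\<^sub>v m" if "z \<in> carrier_vec N" for z
  proof -
    have "V *\<^sub>v (K' *\<^sub>v conjugate z) = (V * R) *\<^sub>v (K *\<^sub>v conjugate (R *\<^sub>v z))"
      unfolding K'_apply[OF that] using c R K that by simp
    also have "\<dots> = 0\<^sub>v m" unfolding VR using R K that by (intro eq_vecI) auto
    finally show ?thesis .
  qed
  have ker: "V *\<^sub>v z = 0\<^sub>v m" if z: "z \<in> carrier_vec N" and "V *\<^sub>v (a \<cdot>\<^sub>v z) = 0\<^sub>v m" "a \<noteq> 0" for a z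
  proof -
    have "a \<cdot>\<^sub>v (V *\<^sub>v z) = 0\<^sub>v m" using that mult_mat_vec[OF c(2) z] by simp
    thus ?thesis using \<open>a \<noteq> 0\<close> c by (auto simp: vec_eq_iff)
  qed
  \<comment> \<open>Up to a nonzero factor, \<open>x\<close> is in the range of \<open>K'\<close>,
    which \<open>V\<close> annihilates; the same holds for \<open>y\<close>.\<close>
  have Vx: "V *\<^sub>v x = 0\<^sub>v m" using ker[OF xy(1)] VK'[OF xy(2)] xy(3) unfolding xy(8) by simp
  have Vy: "V *\<^sub>v y = 0\<^sub>v m" using ker[OF xy(2)] VK'[OF xy(1)] xy(3) unfolding xy(7) by simp
  show thesis
    by (rule that[OF xy(1-6)]) (use xy Vx Vy V0 K'_eq in auto)
qed

text \<open>Induction on the number of pairs. The members of a pair sit at adjacent indices, so a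
  new pair is appended without moving earlier ones. With \<open>2 * k = N\<close> the result is an
  orthonormal basis.\<close>

lemma skew_orthonormal_pairs:
  fixes K :: "complex mat"
  assumes K: "K \<in> carrier_mat N N" and sk: "K\<^sup>T = - K" and inj: "det K \<noteq> 0"
    and k: "2 * k \<le> N"
  shows "\<exists>w s. (\<forall>i<2*k. w i \<in> carrier_vec N) \<and>
    (\<forall>i<2*k. \<forall>j<2*k. w i \<bullet>c w j = (if i = j then 1 else 0)) \<and>
    (\<forall>i<k. s i > (0::real) \<and>
      K *\<^sub>v conjugate (w (2*i)) = - complex_of_real (s i) \<cdot>\<^sub>v w (2*i+1) \<and>
      K *\<^sub>v conjugate (w (2*i+1)) = complex_of_real (s i) \<cdot>\<^sub>v w (2*i))"
  using k
proof (induction k)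
  case (Suc k)
  obtain w s where *: "\<forall>i<2*k. w i \<in> carrier_vec N"
    "\<forall>i<2*k. \<forall>j<2*k. w i \<bullet>c w j = (if i = j then 1 else 0)"
    "\<forall>i<k. s i > (0::real) \<and>
      K *\<^sub>v conjugate (w (2*i)) = - complex_of_real (s i) \<cdot>\<^sub>v w (2*i+1) \<and>
      K *\<^sub>v conjugate (w (2*i+1)) = complex_of_real (s i) \<cdot>\<^sub>v w (2*i)"
    using Suc.IH Suc.prems by (metis Suc_leD mult_Suc_right add_2_eq_Suc)
  have w: "\<And>i. i < 2*k \<Longrightarrow> w i \<in> carrier_vec N"
    and orth: "\<And>i j. i < 2*k \<Longrightarrow> j < 2*k \<Longrightarrow> w i \<bullet>c w j = (if i = j then 1 else 0)"
    and s: "\<And>i. i < k \<Longrightarrow> s i > 0"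
    and K1: "\<And>i. i < k \<Longrightarrow> K *\<^sub>v conjugate (w (2*i)) = - complex_of_real (s i) \<cdot>\<^sub>v w (2*i+1)"
    and K2: "\<And>i. i < k \<Longrightarrow> K *\<^sub>v conjugate (w (2*i+1)) = complex_of_real (s i) \<cdot>\<^sub>v w (2*i)"
    using * by blast+
  have kN: "2 * k < N" using Suc.prems by simp
  \<comment> \<open>Skewness moves \<tau> from \<open>z\<close> to \<open>w i\<close>, and \<tau>
    sends \<open>w i\<close> to a multiple of its partner \<open>w j\<close>, to which
    \<open>z\<close> is orthogonal.\<close>
  have inv: "(K *\<^sub>v conjugate z) \<bullet>c w i = 0"
    if z: "z \<in> carrier_vec N" and zw: "\<And>j. j < 2*k \<Longrightarrow> z \<bullet>c w j = 0" and i: "i < 2*k" for z i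
  proof -
    obtain j c where j: "j < 2*k" and Kj: "K *\<^sub>v conjugate (w i) = c \<cdot>\<^sub>v w j"
    proof (cases "even i")
      case True
      then obtain l where "i = 2 * l" by auto
      with i K1[of l] that[of "2*l+1"] show thesis by auto
    next
      case False
      then obtain l where "i = 2 * l + 1" by (auto elim: oddE)
      with i K2[of l] that[of "2*l"] show thesis by auto
    qed
    have "(K *\<^sub>v conjugate z) \<bullet>c w i = - ((c \<cdot>\<^sub>v w j) \<bullet> conjugate z)"
      using skew_scalar_prod[OF K sk, of "conjugate z" "conjugate (w i)"] z w[OF i] by (simp add: Kj)
    also have "\<dots> = - (c * cnj (z \<bullet>c w j))"
      using z w[OF j] cscalar_prod_swap[OF z w[OF j]] by simp
    finally show ?thesis using zw[OF j] by simp
  qed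
  obtain x y and t :: real where xy: "x \<in> carrier_vec N" "y \<in> carrier_vec N" "t > 0"
    "x \<bullet>c x = 1" "y \<bullet>c y = 1" "x \<bullet>c y = 0"
    "K *\<^sub>v conjugate x = - complex_of_real t \<cdot>\<^sub>v y" "K *\<^sub>v conjugate y = complex_of_real t \<cdot>\<^sub>v x"
    "\<And>i. i < 2*k \<Longrightarrow> x \<bullet>c w i = 0" "\<And>i. i < 2*k \<Longrightarrow> y \<bullet>c w i = 0"
    by (rule skew_pair_orthogonal[OF K sk inj, where m = "2 * k" and w = w])
      (use w kN orth inv in blast)+
  have yx: "y \<bullet>c x = 0" using cscalar_prod_swap[OF xy(1,2)] xy(6) by simp
  have wx: "w i \<bullet>c x = 0" "w i \<bullet>c y = 0" if "i < 2*k" for i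
    using cscalar_prod_swap[OF xy(1) w[OF that]] cscalar_prod_swap[OF xy(2) w[OF that]] xy(9,10) that by auto
  define w' where "w' = w(2*k := x, 2*k+1 := y)"
  define s' where "s' = s(k := t)"
  have w'_old: "w' i = w i" if "i < 2*k" for i using that by (simp add: w'_def)
  have w'_new: "w' (2*k) = x" "w' (2*k+1) = y" by (auto simp: w'_def)
  have lt: "i < 2 * Suc k \<longleftrightarrow> i < 2*k \<or> i = 2*k \<or> i = 2*k+1" for i by auto
  show ?case
  proof (intro exI[of _ w'] exI[of _ s'] conjI allI impI)
    show "w' i \<in> carrier_vec N" if "i < 2 * Suc k" for i
      using that w xy(1,2) unfolding lt by (auto simp: w'_def)
    show "w' i \<bullet>c w' j = (if i = j then 1 else 0)" if "i < 2 * Suc k" "j < 2 * Suc k" for i j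
      using that unfolding lt using orth xy(4-6,9,10) yx wx
      by (elim disjE) (simp_all only: w'_old w'_new, auto)
    fix i assume "i < Suc k"
    hence i: "i < k \<or> i = k" by auto
    show "s' i > 0" using i s xy(3) by (auto simp: s'_def)
    show "K *\<^sub>v conjugate (w' (2*i)) = - complex_of_real (s' i) \<cdot>\<^sub>v w' (2*i+1)"
      using i
    proof
      assume "i < k"
      thus ?thesis using K1[of i] w'_old[of "2*i"] w'_old[of "2*i+1"] by (simp add: s'_def)
    qed (simp only: w'_new xy, simp add: s'_def)
    show "K *\<^sub>v conjugate (w' (2*i+1)) = complex_of_real (s' i) \<cdot>\<^sub>v w' (2*i)"
      using i
    proof
      assume "i < k"
      thus ?thesis using K2[of i] w'_old[of "2*i"] w'_old[of "2*i+1"] by (simp add: s'_def)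
    qed (simp only: w'_new xy, simp add: s'_def)
  qed
qed auto

section \<open>Doubled diagonal matrices and the form \<open>J_mat\<close>\<close>

text \<open>Taking the diagonal as a function makes products, inverses and square roots pointwise
  operations on \<open>d\<close>.\<close>

definition double_diag :: "nat \<Rightarrow> (nat \<Rightarrow> real) \<Rightarrow> complex mat" where
  "double_diag n d = mat_diag (2 * n) (\<lambda>i. complex_of_real (d (if i < n then i else i - n)))"

lemma double_diag_carrier [simp]: "double_diag n d \<in> carrier_mat (2 * n) (2 * n)"
  by (simp add: double_diag_def)

lemma double_diag_dim [simp]: "dim_row (double_diag n d) = 2 * n" "dim_col (double_diag n d) = 2 * n"
  using carrier_matD[OF double_diag_carrier] by auto

lemma double_diag_transpose [simp]: "(double_diag n d)\<^sup>T = double_diag n d"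
  by (intro eq_matI) (auto simp: double_diag_def mat_diag_def)

lemma double_diag_cnj [simp]: "map_mat cnj (double_diag n d) = double_diag n d"
  by (intro eq_matI) (auto simp: double_diag_def mat_diag_def)

lemma double_diag_mult [simp]: "double_diag n d * double_diag n e = double_diag n (\<lambda>i. d i * e i)"
  by (simp add: double_diag_def)

lemma double_diag_cong: "(\<And>i. i < n \<Longrightarrow> d i = e i) \<Longrightarrow> double_diag n d = double_diag n e"
  by (intro eq_matI) (auto simp: double_diag_def mat_diag_def)

lemma double_diag_one [simp]: "double_diag n (\<lambda>_. 1) = 1\<^sub>m (2 * n)"
  by (simp add: double_diag_def)

lemma double_block_eq_double_diag:
  assumes "positive_diagonal n \<Sigma>"
  shows "double_block n \<Sigma> = double_diag n (\<lambda>i. \<Sigma> $$ (i,i))"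
  using assms
  by (intro eq_matI)
    (auto simp: positive_diagonal_def double_block_def double_diag_def mat_diag_def diagonal_mat_def)

lemma J_mat_carrier [simp]: "J_mat n \<in> carrier_mat (2 * n) (2 * n)"
  by (simp add: J_mat_def mult_2)

lemma J_mat_dim [simp]: "dim_row (J_mat n) = 2 * n" "dim_col (J_mat n) = 2 * n"
  using carrier_matD[OF J_mat_carrier] by auto

lemma J_mat_index:
  assumes "i < 2 * n" "j < 2 * n"
  shows "J_mat n $$ (i,j) = (if j = i + n then 1 else if i = j + n then - 1 else 0)"
  using assms by (auto simp: J_mat_def)

lemma J_mat_transpose: "(J_mat n)\<^sup>T = - J_mat n"
  by (intro eq_matI) (auto simp: J_mat_index)

lemma J_mat_cnj: "map_mat cnj (J_mat n) = J_mat n"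
  by (intro eq_matI) (auto simp: J_mat_index)

lemma J_mat_square: "J_mat n * J_mat n = - 1\<^sub>m (2 * n)"
proof -
  have "J_mat n * J_mat n = four_block_mat (- 1\<^sub>m n) (0\<^sub>m n n) (0\<^sub>m n n) (- 1\<^sub>m n)"
    unfolding J_mat_def
    by (subst mult_four_block_mat[of _ n n _ n _ n _ _ n _ n]) auto
  also have "\<dots> = - 1\<^sub>m (2 * n)" by (intro eq_matI) auto
  finally show ?thesis .
qed

text \<open>\<open>J_mat\<close> exchanges the two halves of the coordinates up to sign, and the
  diagonal is the same on both halves.\<close>

lemma J_mat_double_diag: "J_mat n * double_diag n d = double_diag n d * J_mat n"
  unfolding double_diag_def mat_diag_mult_left[OF J_mat_carrier] mat_diag_mult_right[OF J_mat_carrier]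
  by (intro eq_matI) (auto simp: J_mat_index)

lemma double_diag_J_double_diag:
  "double_diag n d * J_mat n * double_diag n d = double_diag n (\<lambda>i. d i * d i) * J_mat n"
proof -
  let ?D = "double_diag n d"
  have "?D * J_mat n * ?D = ?D * (J_mat n * ?D)"
    by (rule assoc_mult_mat[of _ "2*n" "2*n" _ "2*n" _ "2*n"]) simp_all
  also have "\<dots> = ?D * (?D * J_mat n)" by (simp only: J_mat_double_diag)
  also have "\<dots> = (?D * ?D) * J_mat n"
    by (rule assoc_mult_mat[of _ "2*n" "2*n" _ "2*n" _ "2*n", symmetric]) simp_all
  finally show ?thesis by (simp only: double_diag_mult)
qed

text \<open>The hypothesis exhibits \<open>- (J * T\<^sup>T * J)\<close> as a right inverse of
  \<open>T\<close>. For square matrices it is also a left inverse, and multiplying that equation by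
  \<open>J\<close> gives the claim. This passes between the symplectic conditions for a matrix and
  for its transpose.\<close>

lemma skew_form_transpose:
  assumes T: "T \<in> carrier_mat (2 * n) (2 * n)" and TJ: "T * J_mat n * T\<^sup>T = J_mat n"
  shows "T\<^sup>T * J_mat n * T = J_mat n"
proof -
  note [simp] = assoc_mult_mat[of _ "2*n" "2*n" _ "2*n" _ "2*n"] mult_carrier_mat[of _ "2*n" "2*n" _ "2*n"]
  define J where "J = J_mat n"
  have J: "J \<in> carrier_mat (2*n) (2*n)" "J * J = - 1\<^sub>m (2*n)" by (simp_all add: J_def J_mat_square)
  have "T * (J * T\<^sup>T * J) = (T * J * T\<^sup>T) * J" using T J by simp
  also have "\<dots> = - 1\<^sub>m (2*n)" using TJ J by (simp add: J_def)
  finally have "T * (- (J * T\<^sup>T * J)) = 1\<^sub>m (2*n)" using T J by simp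
  hence "- (J * T\<^sup>T * J) * T = 1\<^sub>m (2*n)"
    using T J by (intro mat_mult_left_right_inverse[of T "2*n"]) auto
  hence "- (J * T\<^sup>T * J * T) = 1\<^sub>m (2*n)" using T J by simp
  hence "J * T\<^sup>T * J * T = - 1\<^sub>m (2*n)" by (metis uminus_uminus_mat)
  hence "J * (J * T\<^sup>T * J * T) = - J" using J by simp
  moreover have "J * (J * T\<^sup>T * J * T) = (J * J) * (T\<^sup>T * J * T)" using T J(1) by simp
  ultimately have "- (T\<^sup>T * J * T) = - J" using T J by simp
  thus ?thesis by (simp add: J_def)
qed

section \<open>Youla decomposition of an invertible skew-symmetric matrix\<close>

text \<open>These are the entrywise conjugates of the two unitarity equations. They are the form
  that fits a congruence by \<open>U\<close> and its plain transpose.\<close>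

lemma unitary_mat_cnj:
  assumes "unitary_mat m U"
  shows "map_mat cnj U * U\<^sup>T = 1\<^sub>m m" "U\<^sup>T * map_mat cnj U = 1\<^sub>m m"
proof -
  have U: "U \<in> carrier_mat m m" "map_mat cnj U\<^sup>T * U = 1\<^sub>m m" "U * map_mat cnj U\<^sup>T = 1\<^sub>m m"
    using assms by (auto simp: unitary_mat_def mat_adjoint_eq)
  have 1: "map_mat cnj (1\<^sub>m m) = 1\<^sub>m m" by (intro eq_matI) auto
  show "map_mat cnj U * U\<^sup>T = 1\<^sub>m m"
    using arg_cong[OF U(3), of "map_mat cnj"] U(1) by (simp add: map_cnj_mult[of _ m m _ m] 1)
  show "U\<^sup>T * map_mat cnj U = 1\<^sub>m m"
    using arg_cong[OF U(2), of "map_mat cnj"] U(1) by (simp add: map_cnj_mult[of _ m m _ m] 1)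
qed

lemma mult_mat_unit_vec:
  fixes A :: "'a::semiring_1 mat"
  assumes "A \<in> carrier_mat nr nc" "j < nc"
  shows "A *\<^sub>v unit_vec nc j = col A j"
  using assms by (intro eq_vecI) auto

text \<open>With the orthonormal pairs as columns of \<open>U\<close>, the action of \<tau> on the
  basis reads \<open>K * map_mat cnj U = U * M\<close>, where \<open>M\<close> is the desired middle
  factor; cancelling the conjugate of \<open>U\<close> isolates \<open>K\<close>.\<close>

lemma youla_decomposition:
  fixes K :: "complex mat"
  assumes K: "K \<in> carrier_mat (2*n) (2*n)" and sk: "K\<^sup>T = - K" and inj: "det K \<noteq> 0"
  obtains U d where "unitary_mat (2*n) U" "\<And>i. i < n \<Longrightarrow> d i > 0"
    "K = U * (double_diag n d * J_mat n * double_diag n d) * U\<^sup>T"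
proof -
  let ?N = "2 * n"
  note [simp] = assoc_mult_mat[of _ ?N ?N _ ?N _ ?N] mult_carrier_mat[of _ ?N ?N _ ?N]
  obtain w s where w: "\<And>i. i < ?N \<Longrightarrow> w i \<in> carrier_vec ?N"
    and orth: "\<And>i j. i < ?N \<Longrightarrow> j < ?N \<Longrightarrow> w i \<bullet>c w j = (if i = j then 1 else 0)"
    and s: "\<And>i. i < n \<Longrightarrow> s i > (0::real)"
    and K1: "\<And>i. i < n \<Longrightarrow> K *\<^sub>v conjugate (w (2*i)) = - complex_of_real (s i) \<cdot>\<^sub>v w (2*i+1)"
    and K2: "\<And>i. i < n \<Longrightarrow> K *\<^sub>v conjugate (w (2*i+1)) = complex_of_real (s i) \<cdot>\<^sub>v w (2*i)"
    using skew_orthonormal_pairs[OF K sk inj order_refl] by blast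
  \<comment> \<open>\<open>p\<close> sorts the interleaved pairs into first and second halves.\<close>
  define p where "p j = (if j < n then 2 * j else 2 * (j - n) + 1)" for j
  have p: "p j < ?N" if "j < ?N" for j using that by (auto simp: p_def)
  have p_inj: "p i = p j \<longleftrightarrow> i = j" for i j
    by (auto simp: p_def) presburger+
  define U where "U = mat ?N ?N (\<lambda>(a,j). w (p j) $ a)"
  have U: "U \<in> carrier_mat ?N ?N" by (simp add: U_def)
  have colU: "col U j = w (p j)" if "j < ?N" for j
    using that w[OF p[OF that]] by (intro eq_vecI) (auto simp: U_def)
  have ccolU: "col (map_mat cnj U) j = conjugate (w (p j))" if "j < ?N" for j
    using that w[OF p[OF that]] by (intro eq_vecI) (auto simp: U_def)
  have "map_mat cnj U\<^sup>T * U = 1\<^sub>m ?N"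
  proof (rule eq_matI)
    fix i j assume "i < dim_row (1\<^sub>m ?N)" "j < dim_col (1\<^sub>m ?N)"
    hence ij: "i < ?N" "j < ?N" by auto
    have "row (map_mat cnj U\<^sup>T) i = col (map_mat cnj U) i" using U ij by (intro eq_vecI) auto
    moreover have "(map_mat cnj U\<^sup>T * U) $$ (i,j) = row (map_mat cnj U\<^sup>T) i \<bullet> col U j"
      using U ij by (intro index_mult_mat(1)) auto
    ultimately have "(map_mat cnj U\<^sup>T * U) $$ (i,j) = conjugate (w (p i)) \<bullet> w (p j)"
      by (simp only: colU[OF ij(2)] ccolU[OF ij(1)])
    also have "\<dots> = w (p j) \<bullet>c w (p i)" using w[OF p[OF ij(1)]] w[OF p[OF ij(2)]]
      by (intro comm_scalar_prod[of _ ?N]) auto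
    finally show "(map_mat cnj U\<^sup>T * U) $$ (i,j) = 1\<^sub>m ?N $$ (i,j)"
      using ij orth[OF p[OF ij(2)] p[OF ij(1)]] by (auto simp: p_inj)
  qed (use U in auto)
  hence unit: "unitary_mat ?N U"
    using mat_mult_left_right_inverse[of "map_mat cnj U\<^sup>T" ?N U] U by (simp add: unitary_mat_def mat_adjoint_eq)
  \<comment> \<open>The middle factor contains the doubled diagonal twice, so it carries the squares
    of \<open>d\<close>.\<close>
  define d where "d i = sqrt (s i)" for i
  have d: "d i > 0" "d i * d i = s i" if "i < n" for i using s[OF that] by (auto simp: d_def)
  define M where "M = double_diag n d * J_mat n * double_diag n d"
  have M: "M \<in> carrier_mat ?N ?N" by (simp add: M_def)
  have "M = double_diag n s * J_mat n"
    unfolding M_def double_diag_J_double_diag using d(2) by (metis (no_types, lifting) double_diag_cong)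
  hence M_eq: "M = mat ?N ?N (\<lambda>(i,j). complex_of_real (s (if i < n then i else i - n)) * J_mat n $$ (i,j))"
    unfolding double_diag_def mat_diag_mult_left[OF J_mat_carrier] .
  have KU: "K * map_mat cnj U = U * M"
  proof (rule mat_col_eqI)
    fix j assume "j < dim_col (U * M)"
    hence j: "j < ?N" using M by simp
    have "col (K * map_mat cnj U) j = K *\<^sub>v conjugate (w (p j))"
      unfolding ccolU[OF j, symmetric] using K U j by (intro col_mult2) auto
    also have "\<dots> = U *\<^sub>v col M j"
    proof (cases "j < n")
      case True
      have "col M j = - complex_of_real (s j) \<cdot>\<^sub>v unit_vec ?N (j + n)"
        using True j by (intro eq_vecI) (auto simp: M_eq J_mat_index)
      moreover have "U *\<^sub>v (- complex_of_real (s j) \<cdot>\<^sub>v unit_vec ?N (j + n)) = - complex_of_real (s j) \<cdot>\<^sub>v (w (2*j+1))"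
        using True colU[of "j+n"] mult_mat_unit_vec[OF U, of "j+n"]
        by (subst mult_mat_vec[OF U]) (auto simp: p_def)
      ultimately show ?thesis using K1[OF True] True by (simp add: p_def)
    next
      case False
      hence jn: "j - n < n" using j by auto
      have "col M j = complex_of_real (s (j - n)) \<cdot>\<^sub>v unit_vec ?N (j - n)"
        using False j by (intro eq_vecI) (auto simp: M_eq J_mat_index)
      moreover have "U *\<^sub>v (complex_of_real (s (j - n)) \<cdot>\<^sub>v unit_vec ?N (j - n)) = complex_of_real (s (j - n)) \<cdot>\<^sub>v (w (2*(j-n)))"
        using jn colU[of "j-n"] mult_mat_unit_vec[OF U, of "j-n"]
        by (subst mult_mat_vec[OF U]) (auto simp: p_def)
      ultimately show ?thesis using K2[OF jn] False by (simp add: p_def)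
    qed
    also have "\<dots> = col (U * M) j" using U M j by (intro col_mult2[symmetric]) auto
    finally show "col (K * map_mat cnj U) j = col (U * M) j" .
  qed (use K U M in auto)
  \<comment> \<open>The transpose of \<open>U\<close> inverts its entrywise conjugate.\<close>
  have "K = K * (map_mat cnj U * U\<^sup>T)" using K by (simp add: unitary_mat_cnj[OF unit])
  also have "\<dots> = U * M * U\<^sup>T" using K U by (simp flip: KU)
  finally show thesis using that[OF unit d(1)] by (simp add: M_def)
qed

section \<open>Uniqueness from the spectrum of \<open>K\<close> times its conjugate\<close>

lemma mset_map_double: "mset (map (\<lambda>i. f (if i < n then i else i - n)) [0..<2*n]) =
  repeat_mset 2 (image_mset f (mset_set {..<n}))"
proof -
  have "[0..<2*n] = [0..<n] @ [n..<n+n]" using upt_add_eq_append[of 0 n n] by (simp add: mult_2)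
  also have "[n..<n+n] = map (\<lambda>i. i + n) [0..<n]" by (simp add: map_add_upt)
  finally have "map (\<lambda>i. f (if i < n then i else i - n)) [0..<2*n] = map f [0..<n] @ map f [0..<n]"
    by (simp only: map_append map_map) auto
  thus ?thesis by (simp add: numeral_2_eq_2 mset_upt lessThan_atLeast0)
qed

lemma proots_linear_factors: "proots (\<Prod>a\<leftarrow>as. [:- a, 1::'a::idom:]) = mset as"
proof (induction as)
  case (Cons a as)
  have "proots ([:- a, 1:] * (\<Prod>a\<leftarrow>as. [:- a, 1:])) = add_mset a (mset as)"
    by (subst proots_mult) (auto simp: Cons.IH)
  thus ?case by (simp only: list.map prod_list.Cons mset.simps)
qed simp

text \<open>In the product of \<open>K\<close> with its conjugate, the transpose of \<open>U\<close>
  meets the conjugate of \<open>U\<close> and cancels. What remains is unitarily similar to the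
  square of the real middle factor. Since the doubled diagonal commutes with \<open>J_mat\<close>,
  whose square is minus the identity, this square is diagonal with entries
  \<open>- (d i ^ 4)\<close>, each occurring once in either half.\<close>

lemma proots_skew_decomposition:
  assumes unit: "unitary_mat (2*n) U"
    and K: "K = U * (double_diag n d * J_mat n * double_diag n d) * U\<^sup>T"
  shows "proots (char_poly (K * map_mat cnj K)) =
    repeat_mset 2 (image_mset (\<lambda>i. complex_of_real (- (d i ^ 4))) (mset_set {..<n}))"
proof -
  let ?N = "2 * n" and ?D = "double_diag n d" and ?D2 = "double_diag n (\<lambda>i. d i * d i)"
  note [simp] = assoc_mult_mat[of _ ?N ?N _ ?N _ ?N] mult_carrier_mat[of _ ?N ?N _ ?N] map_cnj_mult[of _ ?N ?N _ ?N]
  define M where "M = ?D * J_mat n * ?D"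
  have M: "M \<in> carrier_mat ?N ?N" "map_mat cnj M = M" by (simp_all add: M_def J_mat_cnj)
  have U: "U \<in> carrier_mat ?N ?N" "map_mat cnj U\<^sup>T * U = 1\<^sub>m ?N" "U * map_mat cnj U\<^sup>T = 1\<^sub>m ?N"
    using unit by (auto simp: unitary_mat_def mat_adjoint_eq)
  have c: "map_mat cnj (U * M * U\<^sup>T) = map_mat cnj U * M * map_mat cnj U\<^sup>T"
    using U(1) M by simp
  have "K * map_mat cnj K = (U * M * U\<^sup>T) * (map_mat cnj U * M * map_mat cnj U\<^sup>T)"
    unfolding K M_def[symmetric] c ..
  also have "\<dots> = U * (M * (U\<^sup>T * map_mat cnj U) * M) * map_mat cnj U\<^sup>T"
    using U(1) M(1) by simp
  also have "M * (U\<^sup>T * map_mat cnj U) * M = M * M"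
    unfolding unitary_mat_cnj(2)[OF unit] using M(1) by simp
  also have "M * M = (?D2 * J_mat n) * (?D2 * J_mat n)"
    by (simp only: M_def double_diag_J_double_diag)
  also have "\<dots> = ?D2 * (J_mat n * ?D2) * J_mat n" by simp
  also have "\<dots> = ?D2 * (?D2 * J_mat n) * J_mat n" by (simp only: J_mat_double_diag)
  also have "\<dots> = ?D2 * (?D2 * (J_mat n * J_mat n))" by simp
  also have "\<dots> = - (?D2 * ?D2)"
    unfolding J_mat_square by (simp del: double_diag_mult)
  also have "\<dots> = double_diag n (\<lambda>i. - (d i ^ 4))"
    unfolding double_diag_mult
    by (intro eq_matI) (auto simp: double_diag_def mat_diag_def power4_eq_xxxx)
  finally have KK: "K * map_mat cnj K = U * double_diag n (\<lambda>i. - (d i ^ 4)) * map_mat cnj U\<^sup>T" .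
  let ?E = "double_diag n (\<lambda>i. - (d i ^ 4))"
  have "similar_mat_wit (K * map_mat cnj K) ?E U (map_mat cnj U\<^sup>T)"
    using U KK by (intro similar_mat_witI[of _ _ ?N]) auto
  hence "char_poly (K * map_mat cnj K) = char_poly ?E"
    by (intro char_poly_similar) (auto simp: similar_mat_def)
  also have "\<dots> = (\<Prod>a\<leftarrow>diag_mat ?E. [:- a, 1:])"
    by (rule char_poly_upper_triangular[OF double_diag_carrier])
      (auto simp: double_diag_def mat_diag_def upper_triangular_def)
  also have "diag_mat ?E = map (\<lambda>i. complex_of_real (- (d (if i < n then i else i - n) ^ 4))) [0..<2*n]"
    by (auto simp: diag_mat_def double_diag_def mat_diag_def)
  finally show ?thesis
    using mset_map_double[of "\<lambda>i. complex_of_real (- (d i ^ 4))" n] by (simp only: proots_linear_factors)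
qed

lemma repeat_mset_2_cancel: "repeat_mset 2 A = repeat_mset 2 B \<longleftrightarrow> A = B"
  by (simp add: multiset_eq_iff)

text \<open>The symplectic factor drops out because it preserves the form:
  \<open>S * J_mat n * S\<^sup>T = J_mat n\<close>.\<close>

lemma skew_form_of_decomposition:
  assumes pd: "positive_diagonal n \<Sigma>" and unit: "unitary_mat (2*n) U" and S: "complex_symplectic n S"
    and G: "G = U * double_block n \<Sigma> * S"
  shows "G * J_mat n * G\<^sup>T = U * (double_diag n (\<lambda>i. \<Sigma> $$ (i,i)) * J_mat n * double_diag n (\<lambda>i. \<Sigma> $$ (i,i))) * U\<^sup>T"
proof -
  let ?N = "2 * n" and ?D = "double_diag n (\<lambda>i. \<Sigma> $$ (i,i))"
  note [simp] = assoc_mult_mat[of _ ?N ?N _ ?N _ ?N] mult_carrier_mat[of _ ?N ?N _ ?N] transpose_mult[of _ ?N ?N _ ?N]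
  have c: "U \<in> carrier_mat ?N ?N" "S \<in> carrier_mat ?N ?N"
    using unit S by (auto simp: unitary_mat_def complex_symplectic_def)
  have SJ: "S * J_mat n * S\<^sup>T = J_mat n"
    using skew_form_transpose[of "S\<^sup>T" n] S c by (simp add: complex_symplectic_def del: assoc_mult_mat)
  have "G * J_mat n * G\<^sup>T = U * ?D * (S * J_mat n * S\<^sup>T) * (?D * U\<^sup>T)"
    unfolding G double_block_eq_double_diag[OF pd] using c by simp
  thus ?thesis unfolding SJ using c by simp
qed


text \<open>Both factorizations give the same \<open>G * J_mat n * G\<^sup>T\<close>, hence the same
  multiset of roots. Halving multiplicities leaves the negated fourth powers of the diagonal
  entries.\<close>

lemma decomposition_unique:
  assumes pd: "positive_diagonal n \<Sigma>" "positive_diagonal n \<Sigma>'"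
    and unit: "unitary_mat (2*n) U" "unitary_mat (2*n) U'"
    and S: "complex_symplectic n S" "complex_symplectic n S'"
    and eq: "U * double_block n \<Sigma> * S = U' * double_block n \<Sigma>' * S'"
  shows "equal_up_to_diagonal_permutation n \<Sigma> \<Sigma>'"
proof -
  define G where "G = U * double_block n \<Sigma> * S"
  have G': "G = U' * double_block n \<Sigma>' * S'" using eq by (simp add: G_def)
  \<comment> \<open>\<open>h\<close> recovers a positive \<open>d\<close> from
    \<open>- (d ^ 4)\<close>; positivity is what makes the fourth root unambiguous.\<close>
  define h where "h z = sqrt (sqrt (- Re z))" for z
  have h: "image_mset h (image_mset (\<lambda>i. complex_of_real (- (X $$ (i,i) ^ 4))) (mset_set {..<n})) =
    image_mset (\<lambda>i. X $$ (i,i)) (mset_set {..<n})" if "positive_diagonal n X" for X :: "real mat"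
  proof -
    have "h (complex_of_real (- (X $$ (i,i) ^ 4))) = X $$ (i,i)" if "i < n" for i
    proof -
      have "X $$ (i,i) > 0" using \<open>positive_diagonal n X\<close> that by (simp add: positive_diagonal_def)
      moreover have "X $$ (i,i) ^ 4 = ((X $$ (i,i))\<^sup>2)\<^sup>2" by simp
      ultimately show ?thesis unfolding h_def by (simp only: Re_complex_of_real minus_minus real_sqrt_abs) simp
    qed
    thus ?thesis by (auto simp: multiset.map_comp intro!: image_mset_cong)
  qed
  have "image_mset (\<lambda>i. complex_of_real (- (\<Sigma> $$ (i,i) ^ 4))) (mset_set {..<n}) =
    image_mset (\<lambda>i. complex_of_real (- (\<Sigma>' $$ (i,i) ^ 4))) (mset_set {..<n})"
    using proots_skew_decomposition[OF unit(1) skew_form_of_decomposition[OF pd(1) unit(1) S(1) G_def]]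
      proots_skew_decomposition[OF unit(2) skew_form_of_decomposition[OF pd(2) unit(2) S(2) G']]
    by (simp only: repeat_mset_2_cancel)
  from arg_cong[OF this, of "image_mset h"]
  have "image_mset (\<lambda>i. \<Sigma>' $$ (i,i)) (mset_set {..<n}) = image_mset (\<lambda>i. \<Sigma> $$ (i,i)) (mset_set {..<n})"
    unfolding h[OF pd(1)] h[OF pd(2)] by simp
  \<comment> \<open>Two families over the same finite index set with equal multisets of values
    differ by a permutation of the indices.\<close>
  then obtain p where "p permutes {..<n}" "\<forall>x\<in>{..<n}. \<Sigma>' $$ (x,x) = \<Sigma> $$ (p x, p x)"
    by (rule image_mset_eq_implies_permutes[OF finite_lessThan])
  thus ?thesis by (auto simp: equal_up_to_diagonal_permutation_def)
qed

section \<open>Existence of the factorization\<close>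

text \<open>A Youla decomposition of \<open>G * J_mat n * G\<^sup>T\<close> supplies
  \<open>U\<close> and the diagonal; solving the factorization for the last factor then leaves only
  its symplecticity to be checked.\<close>

lemma decomposition_exists:
  assumes G: "G \<in> carrier_mat (2 * n) (2 * n)" and inv: "invertible_mat G"
  obtains \<Sigma> U S where "positive_diagonal n \<Sigma>" "unitary_mat (2 * n) U" "complex_symplectic n S"
    "G = U * double_block n \<Sigma> * S"
proof -
  let ?N = "2 * n" and ?J = "J_mat n"
  note [simp] = assoc_mult_mat[of _ ?N ?N _ ?N _ ?N] mult_carrier_mat[of _ ?N ?N _ ?N]
    transpose_mult[of _ ?N ?N _ ?N]
  obtain B where "G * B = 1\<^sub>m ?N" "B * G = 1\<^sub>m (dim_row B)"
    using inv G by (auto simp: invertible_mat_def inverts_mat_def)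
  \<comment> \<open>\<open>invertible_mat\<close> does not fix the dimensions of the inverse, so
    they are read off from the two product equations.\<close>
  moreover have "dim_row B = ?N" using G arg_cong[OF \<open>B * G = 1\<^sub>m (dim_row B)\<close>, of dim_col] by simp
  moreover have "dim_col B = ?N" using G arg_cong[OF \<open>G * B = 1\<^sub>m ?N\<close>, of dim_col] by simp
  ultimately have "det G * det B = 1"
    using det_mult[OF G, of B] by (auto intro: carrier_matI)
  hence detG: "det G \<noteq> 0" by auto
  \<comment> \<open>The square of \<open>det ?J\<close> is the determinant of minus the identity,
    which is nonzero because that matrix squares to the identity.\<close>
  have "det ?J * det ?J = det (- 1\<^sub>m ?N :: complex mat)"
    using det_mult[OF J_mat_carrier J_mat_carrier, of n] by (simp add: J_mat_square)
  also have "\<dots> \<noteq> 0"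
  proof
    assume "det (- 1\<^sub>m ?N :: complex mat) = 0"
    hence "det (- 1\<^sub>m ?N * (- 1\<^sub>m ?N) :: complex mat) = 0"
      using det_mult[of "- 1\<^sub>m ?N :: complex mat" ?N "- 1\<^sub>m ?N"] by simp
    thus False by simp
  qed
  finally have detJ: "det ?J \<noteq> 0" by auto
  define K where "K = G * ?J * G\<^sup>T"
  have K: "K \<in> carrier_mat ?N ?N" using G by (simp add: K_def)
  have sk: "K\<^sup>T = - K" using G by (simp add: K_def J_mat_transpose)
  have "det K = det G * det ?J * det G"
    using G by (simp add: K_def det_mult[of _ ?N] det_transpose del: assoc_mult_mat)
  hence "det K \<noteq> 0" using detG detJ by simp
  then obtain U d where unit: "unitary_mat ?N U" and d: "\<And>i. i < n \<Longrightarrow> d i > 0"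
    and KU: "K = U * (double_diag n d * ?J * double_diag n d) * U\<^sup>T"
    using youla_decomposition[OF K sk] by metis
  let ?D = "double_diag n d" and ?E = "double_diag n (\<lambda>i. inverse (d i))" and ?U' = "map_mat cnj U\<^sup>T"
  have U: "U \<in> carrier_mat ?N ?N" "?U' * U = 1\<^sub>m ?N" "U * ?U' = 1\<^sub>m ?N"
    using unit by (auto simp: unitary_mat_def mat_adjoint_eq)
  have DE: "?D * ?E = 1\<^sub>m ?N"
  proof -
    have "?D * ?E = double_diag n (\<lambda>_. 1)"
      unfolding double_diag_mult using d by (intro double_diag_cong) (simp add: less_imp_neq[symmetric])
    thus ?thesis by simp
  qed
  hence ED: "?E * ?D = 1\<^sub>m ?N" by (simp add: mult.commute)
  define \<Sigma> where "\<Sigma> = mat_diag n d"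
  have pd: "positive_diagonal n \<Sigma>"
    using d by (auto simp: positive_diagonal_def \<Sigma>_def mat_diag_def diagonal_mat_def)
  have D: "double_block n \<Sigma> = ?D"
    unfolding double_block_eq_double_diag[OF pd] by (intro double_diag_cong) (simp add: \<Sigma>_def mat_diag_def)
  \<comment> \<open>This is the only candidate: the inverse of \<open>U * ?D\<close> times
    \<open>G\<close>.\<close>
  define S where "S = ?E * ?U' * G"
  have S: "S \<in> carrier_mat ?N ?N" using U G by (simp add: S_def)
  have "U * ?D * S = U * (?D * ?E) * ?U' * G"
    using U(1) G by (simp add: S_def del: double_diag_mult)
  also have "\<dots> = (U * ?U') * G" unfolding DE using U(1) G by simp
  also have "\<dots> = G" unfolding U(3) using G by simp
  finally have GS: "G = U * double_block n \<Sigma> * S" by (simp only: D)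
  have U'T: "?U'\<^sup>T = map_mat cnj U" by (intro eq_matI) auto
  have ST: "S\<^sup>T = G\<^sup>T * (map_mat cnj U * ?E)"
    using U(1) G by (simp add: S_def U'T)
  have "S * ?J * S\<^sup>T = ?E * ?U' * K * (map_mat cnj U * ?E)"
    unfolding ST K_def using U(1) G by (simp add: S_def)
  \<comment> \<open>Inserting the Youla form of \<open>K\<close> lets the unitary factors cancel in
    pairs, after which \<open>?E\<close> cancels \<open>?D\<close> on both sides of
    \<open>?J\<close>.\<close>
  also have "\<dots> = ?E * (?U' * U) * (?D * ?J * ?D) * (U\<^sup>T * map_mat cnj U) * ?E"
    unfolding KU using U(1) by simp
  also have "\<dots> = (?E * ?D) * ?J * (?D * ?E)"
    unfolding U(2) unitary_mat_cnj(2)[OF unit] by (simp del: double_diag_mult)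
  also have "\<dots> = ?J" unfolding DE ED by simp
  finally have "S * ?J * S\<^sup>T = ?J" .
  hence "complex_symplectic n S" using S skew_form_transpose[OF S] by (simp add: complex_symplectic_def del: assoc_mult_mat)
  thus thesis using that pd unit GS by blast
qed

theorem theorem5p9:
  fixes n :: nat and G :: "complex mat"
  assumes "G \<in> carrier_mat (2 * n) (2 * n)"
    and "invertible_mat G"
  shows "\<exists>\<Sigma>. positive_diagonal n \<Sigma> \<and>
      (\<exists>U S. unitary_mat (2 * n) U \<and> complex_symplectic n S \<and>
             G = U * double_block n \<Sigma> * S) \<and>
      (\<forall>\<Sigma>' U' S'. positive_diagonal n \<Sigma>' \<and> unitary_mat (2 * n) U' \<and>
             complex_symplectic n S' \<and> G = U' * double_block n \<Sigma>' * S' \<longrightarrow>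
             equal_up_to_diagonal_permutation n \<Sigma> \<Sigma>')"
  using decomposition_exists[OF assms] decomposition_unique by metis

end
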